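(* Let $f\ge0$ be integrable on $[-\pi,\pi]$ with $\int f>0$, let $\sigma_n^2(f)=\min_{q\in\mathcal{Q}_n(1)}\int_{-\pi}^{\pi}|q(e^{i\lambda})|^2f(\lambda)\,d\lambda$ and $\sigma_n(f)=\sqrt{\sigma_n^2(f)}$, and let $E_f=\{e^{i\lambda}:f(\lambda)>0\}$. If $E_f$ is either an arc of the unit circle or the whole unit circle, then $$\lim_{n\to\infty}\sqrt[n]{\sigma_n(f)}=\widetilde\tau(E_f)\le1.$$
   Context: $\mathcal{Q}_n(1)$ denotes the set of complex polynomials of degree at most $n$ with $q(1)=1$; $\sigma_n^2(f)$ is the variance of the BLUE of the constant mean $m$ of $X(t)=m+Y(t)$ from $X(0),\dots,X(n)$, where $Y$ is a centered stationary process with spectral density $f$. For a bounded closed set $F\subset\mathbb{C}$, $\widetilde m_n(F)=\inf_{q\in\mathcal{Q}_n(1)}\max_{z\in F}|q(z)|$ and the generalized Chebyshev constant is $\widetilde\tau(F)=\lim_{n\to\infty}\sqrt[n]{\widetilde m_n(F)}$ (this limit exists). *)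

theory Defs
  imports "HOL-Analysis.Analysis" "HOL-Computational_Algebra.Polynomial"
begin

definition Qn1 :: "nat \<Rightarrow> complex poly set" where
  "Qn1 n = {q. degree q \<le> n \<and> poly q 1 = 1}"

definition sigma_sq :: "(real \<Rightarrow> real) \<Rightarrow> nat \<Rightarrow> real" where
  "sigma_sq f n = Inf ((\<lambda>q. integral {-pi..pi} (\<lambda>l. (cmod (poly q (cis l)))\<^sup>2 * f l)) ` Qn1 n)"

definition sigma :: "(real \<Rightarrow> real) \<Rightarrow> nat \<Rightarrow> real" where
  "sigma f n = sqrt (sigma_sq f n)"

definition E_set :: "(real \<Rightarrow> real) \<Rightarrow> complex set" where
  "E_set f = cis ` {l \<in> {-pi..pi}. f l > 0}"

definition m_tilde :: "nat \<Rightarrow> complex set \<Rightarrow> real" where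
  "m_tilde n F = Inf ((\<lambda>q. SUP z\<in>F. cmod (poly q z)) ` Qn1 n)"

text \<open>Generalized Chebyshev constant (the limit exists).\<close>
definition tau_tilde :: "complex set \<Rightarrow> real" where
  "tau_tilde F = lim (\<lambda>n. root n (m_tilde n F))"

text \<open>An arc of the unit circle (open, closed or half-open, nondegenerate).\<close>
definition is_arc :: "complex set \<Rightarrow> bool" where
  "is_arc E \<longleftrightarrow> (\<exists>a b. a < b \<and> b - a \<le> 2 * pi \<and>
      cis ` {a<..<b} \<subseteq> E \<and> E \<subseteq> cis ` {a..b})"

end

theory Submission
  imports Defs
begin

text \<open>
  Let \<open>m\<^sub>n\<close> be the minimal supremum norm on \<open>E\<^sub>f\<close>. Bounding the integrand pointwise gives
  \<open>\<sigma>\<^sub>n \<le> m\<^sub>n (\<integral>f)\<^sup>1\<^sup>/\<^sup>2\<close>. Conversely, \<open>f \<ge> \<delta> > 0\<close> holds on the arc outside a set of small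
  measure, and by Chebyshev's inequality \<open>|q|\<close> is bounded by a multiple of its weighted \<open>L\<^sup>2\<close> norm
  outside a further small set. A Remez inequality extends this bound to the whole arc at the cost of a
  factor \<open>C\<^sup>n\<close>, where \<open>C\<close> tends to \<open>1\<close> with the measure of the exceptional set. So
  \<open>m\<^sub>n \<le> B C\<^sup>n \<sigma>\<^sub>n\<close> for every \<open>C > 1\<close>, and the \<open>n\<close>-th roots have the same limit.
\<close>

section \<open>A Remez inequality on arcs of the unit circle\<close>

text \<open>Both sides are polynomials in \<open>z\<close> of degree at most \<open>n\<close> that
  agree at the \<open>n + 1\<close> distinct nodes.\<close>

lemma lagrange_interpolation:
  fixes p :: "'a::field poly" and x :: "nat \<Rightarrow> 'a"
  assumes "degree p \<le> n" and inj: "inj_on x {..n}"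
  shows "poly p z = (\<Sum>k\<le>n. poly p (x k) * (\<Prod>j\<in>{..n}-{k}. (z - x j) / (x k - x j)))"
proof -
  define B where "B k = (\<Prod>j\<in>{..n}-{k}. smult (1 / (x k - x j)) [:- x j, 1:])" for k
  define r where "r = (\<Sum>k\<le>n. smult (poly p (x k)) (B k))"
  have B: "poly (B k) w = (\<Prod>j\<in>{..n}-{k}. (w - x j) / (x k - x j))" for k w
    by (simp add: B_def poly_prod diff_divide_distrib)
  have "degree (B k) \<le> n" if "k \<le> n" for k
  proof -
    have "degree (B k) \<le> (\<Sum>j\<in>{..n}-{k}. degree (smult (1 / (x k - x j)) [:- x j, 1:]))"
      using degree_prod_sum_le[of "{..n} - {k}" "\<lambda>j. smult (1 / (x k - x j)) [:- x j, 1:]"]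
      by (simp add: B_def o_def)
    also have "\<dots> \<le> (\<Sum>j\<in>{..n}-{k}. 1)"
      by (intro sum_mono) simp
    also have "\<dots> = n" using that by simp
    finally show ?thesis .
  qed
  then have deg: "degree r \<le> n"
    unfolding r_def by (intro degree_sum_le) (auto intro: order_trans[OF degree_smult_le])
  have node: "poly (B k) (x i) = (if i = k then 1 else 0)" if "i \<le> n" "k \<le> n" for i k
  proof (cases "i = k")
    case True
    then have "x k - x j \<noteq> 0" if "j \<in> {..n} - {k}" for j
      using inj that \<open>k \<le> n\<close> by (auto dest: inj_onD)
    then show ?thesis using True by (auto simp: B intro!: prod.neutral)
  next
    case False
    then have "\<exists>j\<in>{..n}-{k}. (x i - x j) / (x k - x j) = 0"
      using that by (intro bexI[of _ i]) auto
    then show ?thesis using False by (simp add: B)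
  qed
  have "p = r"
  proof (rule poly_eqI_degree[where A = "x ` {..n}"])
    show "poly p w = poly r w" if "w \<in> x ` {..n}" for w
    proof -
      from that obtain i where i: "i \<le> n" "w = x i" by auto
      have "poly r w = (\<Sum>k\<le>n. poly p (x k) * (if i = k then 1 else 0))"
        unfolding r_def i(2) using i by (auto simp: poly_sum node intro!: sum.cong)
      also have "\<dots> = poly p w" using i by (simp add: if_distrib sum.delta cong: if_cong)
      finally show ?thesis by simp
    qed
  qed (use assms deg in \<open>auto simp: card_image\<close>)
  then have "poly p z = poly r z" by simp
  then show ?thesis by (simp add: r_def poly_sum B)
qed

section \<open>Chebyshev polynomials of the first kind\<close>

fun cheb_poly :: "nat \<Rightarrow> real poly" where
  "cheb_poly 0 = 1"
| "cheb_poly (Suc 0) = [:0, 1:]"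
| "cheb_poly (Suc (Suc n)) = [:0, 2:] * cheb_poly (Suc n) - cheb_poly n"

lemma degree_cheb_poly: "degree (cheb_poly n) \<le> n"
proof (induction n rule: cheb_poly.induct)
  case (3 n)
  have "degree ([:0, 2:] * cheb_poly (Suc n)) \<le> degree [:0, 2::real:] + degree (cheb_poly (Suc n))"
    by (rule degree_mult_le)
  then show ?case
    using 3 by (auto intro!: degree_diff_le)
qed auto

lemma poly_cheb_poly_cos: "poly (cheb_poly n) (cos t) = cos (n * t)"
proof (induction n rule: cheb_poly.induct)
  case (3 n)
  have "cos (real (Suc n) * t + t) + cos (real (Suc n) * t - t) = 2 * cos t * cos (Suc n * t)"
    by (simp add: cos_add cos_diff)
  moreover have "real (Suc n) * t + t = Suc (Suc n) * t" "real (Suc n) * t - t = n * t"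
    by (simp_all add: algebra_simps)
  ultimately show ?case using 3 by simp
qed auto

text \<open>The right-hand side satisfies the same three-term recurrence. Every real number at least
  1 is \<open>(u + 1 / u) / 2\<close> for some \<open>u\<close> at least 1, so this controls the
  growth to the right of \<open>[-1, 1]\<close>.\<close>

lemma poly_cheb_poly_joukowski:
  assumes "u \<noteq> 0"
  shows "poly (cheb_poly n) ((u + 1 / u) / 2) = (u ^ n + 1 / u ^ n) / 2"
proof (induction n rule: cheb_poly.induct)
  case (3 n)
  show ?case
    unfolding cheb_poly.simps poly_diff poly_mult 3 using assms by (simp add: field_simps)
qed auto

text \<open>The nodes are the extremal points of the Chebyshev polynomial, where it takes the values
  \<open>\<plusminus>1\<close> with alternating signs; so Lagrange interpolation of it has only positive terms outside
  \<open>[-1, 1]\<close>.\<close>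
lemma sum_abs_lagrange_basis_cheb:
  fixes X :: real and x :: "nat \<Rightarrow> real"
  assumes n: "n > 0" and x: "\<And>k. x k = cos (k * pi / n)"
  shows "(\<Sum>k\<le>n. \<Prod>j\<in>{..n}-{k}. (X - x j) / \<bar>x k - x j\<bar>) = poly (cheb_poly n) X"
    and "inj_on x {..n}"
proof -
  have less: "x k < x j" if "j < k" "k \<le> n" for j k
    unfolding x using that n
    by (intro cos_monotone_0_pi) (auto simp: field_simps)
  show inj: "inj_on x {..n}"
    by (rule inj_onI) (metis atMost_iff less less_irrefl linorder_neqE_nat)
  have val: "poly (cheb_poly n) (x k) = (-1) ^ k" for k
    unfolding x poly_cheb_poly_cos using n cos_npi[of k] by simp
  \<comment> \<open>The nodes decrease with the index, so exactly the \<open>k\<close> factors with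
    \<open>j < k\<close> have a negative denominator; their sign \<open>(-1) ^ k\<close> cancels the
    value at \<open>x k\<close>.\<close>
  have "poly (cheb_poly n) (x k) * (\<Prod>j\<in>{..n}-{k}. (X - x j) / (x k - x j))
      = (\<Prod>j\<in>{..n}-{k}. (X - x j) / \<bar>x k - x j\<bar>)" if k: "k \<le> n" for k
  proof -
    have "(\<Prod>j\<in>{..n}-{k}. (X - x j) / (x k - x j)) =
        (\<Prod>j\<in>{..n}-{k}. (if j < k then -1 else 1) * ((X - x j) / \<bar>x k - x j\<bar>))"
    proof (rule prod.cong)
      fix j assume j: "j \<in> {..n} - {k}"
      then consider "j < k" | "k < j" "j \<le> n" by force
      then show "(X - x j) / (x k - x j) = (if j < k then -1 else 1) * ((X - x j) / \<bar>x k - x j\<bar>)"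
      proof cases
        case 1
        then show ?thesis using less[OF 1 k] by (simp add: divide_simps) (simp add: algebra_simps)
      next
        case 2
        then show ?thesis using less[OF 2] by simp
      qed
    qed simp
    also have "\<dots> = (\<Prod>j\<in>{..n}-{k}. (if j < k then -1 else 1)) *
        (\<Prod>j\<in>{..n}-{k}. (X - x j) / \<bar>x k - x j\<bar>)"
      by (rule prod.distrib)
    also have "(\<Prod>j\<in>{..n}-{k}. (if j < k then -1 else 1)) = (\<Prod>j<k. (-1::real))"
      using k by (intro prod.mono_neutral_cong_right) auto
    finally show ?thesis by (simp add: val flip: power_mult_distrib)
  qed
  then show "(\<Sum>k\<le>n. \<Prod>j\<in>{..n}-{k}. (X - x j) / \<bar>x k - x j\<bar>) = poly (cheb_poly n) X"
    unfolding lagrange_interpolation[OF degree_cheb_poly inj, of X] by simp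
qed

section \<open>A Remez estimate at an endpoint\<close>

text \<open>The distribution function of \<open>A\<close> is 1-Lipschitz, so it takes the value
  \<open>d\<close>. The point found need not lie in \<open>A\<close>; replacing it by the last point
  of \<open>A\<close> before it leaves the intersection unchanged.\<close>

lemma measure_initial_segment_IVT:
  fixes A :: "real set"
  assumes A: "closed A" "A \<subseteq> {0..L}" and ne: "A \<noteq> {}"
    and d: "0 \<le> d" "d \<le> measure lebesgue A"
  obtains t where "t \<in> A" "measure lebesgue (A \<inter> {0..t}) = d"
proof -
  define g where "g t = measure lebesgue (A \<inter> {0..t})" for t
  have comp: "compact A"
    using A by (meson bounded_closed_interval bounded_subset compact_eq_bounded_closed)
  have meas: "A \<inter> {0..t} \<in> lmeasurable" for t
    using comp by (intro lmeasurable_compact compact_Int) auto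
  have lip: "\<bar>g t - g s\<bar> \<le> t - s" if "s \<le> t" for s t
  proof -
    have "g s \<le> g t"
      unfolding g_def using that by (intro measure_mono_fmeasurable meas fmeasurableD) auto
    have "g t \<le> measure lebesgue ((A \<inter> {0..s}) \<union> {s..t})"
      unfolding g_def by (intro measure_mono_fmeasurable fmeasurableD meas fmeasurable.Un) auto
    also have "\<dots> \<le> g s + measure lebesgue {s..t}"
      unfolding g_def by (intro measure_Un_le fmeasurableD meas) auto
    finally show ?thesis using that \<open>g s \<le> g t\<close> by simp
  qed
  have "dist (g t) (g s) \<le> dist t s" for s t
    using lip[of s t] lip[of t s] by (cases "s \<le> t") (auto simp: dist_real_def)
  then have cont: "continuous_on S g" for S
    by (intro continuous_onI) (meson le_less_trans less_eq_real_def)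
  have "L \<ge> 0" using ne A by force
  have "g 0 = 0"
    unfolding g_def by (intro measure_eq_0_null_sets negligible_iff_null_sets[THEN iffD1]
        negligible_subset[OF negligible_sing[of 0]]) auto
  moreover have "g L = measure lebesgue A"
    unfolding g_def using A by (simp add: Int_absorb2)
  ultimately obtain t where t: "0 \<le> t" "t \<le> L" "g t = d"
    using IVT'[of g 0 d L] d cont \<open>L \<ge> 0\<close> by auto
  show thesis
  proof (cases "A \<inter> {0..t} = {}")
    \<comment> \<open>No point of \<open>A\<close> lies to the left, so \<open>d = 0\<close> and the
      least point of \<open>A\<close> serves.\<close>
    case True
    then have "d = 0" using t by (simp add: g_def)
    obtain s where s: "s \<in> A" "\<And>r. r \<in> A \<Longrightarrow> s \<le> r"
      using compact_attains_inf[OF comp ne] by blast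
    then have "A \<inter> {0..s} \<subseteq> {s}" by force
    then have "measure lebesgue (A \<inter> {0..s}) = 0"
      by (intro measure_eq_0_null_sets negligible_iff_null_sets[THEN iffD1]
        negligible_subset[OF negligible_sing[of s]])
    then show ?thesis using that s \<open>d = 0\<close> by simp
  next
    case False
    have "compact (A \<inter> {0..t})" using comp by auto
    then obtain s where s: "s \<in> A \<inter> {0..t}" "\<And>r. r \<in> A \<inter> {0..t} \<Longrightarrow> r \<le> s"
      using compact_attains_sup[OF _ False] by blast
    then have "A \<inter> {0..s} = A \<inter> {0..t}" by force
    then show ?thesis using that[of s] s t by (simp add: g_def)
  qed
qed

text \<open>Lagrange interpolation at points of \<open>A\<close> that become Chebyshev nodes once the gaps of \<open>A\<close>
  are collapsed: collapsing does not increase mutual distances, and decreases the distance to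
  \<open>0\<close> by at most \<open>\<eta>\<close>.\<close>
lemma remez_endpoint:
  fixes A :: "real set" and q :: "complex poly" and z :: "real \<Rightarrow> complex"
  assumes A: "closed A" "A \<subseteq> {0..l + \<eta>}" "measure lebesgue A \<ge> l"
    and l: "l > 0" and \<eta>: "\<eta> \<ge> 0"
    and u: "u \<ge> 1" "1 + 2 * \<eta> / l \<le> (u + 1 / u) / 2"
    and c: "c > 0"
    and z0: "\<And>t. t \<in> {0..l + \<eta>} \<Longrightarrow> cmod (z 0 - z t) \<le> t"
    and zz: "\<And>s t. s \<in> {0..l + \<eta>} \<Longrightarrow> t \<in> {0..l + \<eta>} \<Longrightarrow> c * \<bar>s - t\<bar> \<le> cmod (z s - z t)"
    and n: "n > 0" "degree q \<le> n"
    and M: "\<And>t. t \<in> A \<Longrightarrow> cmod (poly q (z t)) \<le> M"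
  shows "cmod (poly q (z 0)) \<le> M * (u / c) ^ n"
proof -
  \<comment> \<open>\<open>X\<close> is at least \<open>1 + 2 * \<eta> / l\<close>, the image of
    \<open>- \<eta>\<close> under the affine map from \<open>[0, l]\<close> to
    \<open>[-1, 1]\<close> that sends \<open>0\<close> to \<open>1\<close>.\<close>
  define X where "X = (u + 1 / u) / 2"
  define x where "x k = cos (k * pi / n)" for k :: nat
  \<comment> \<open>Chebyshev nodes carried to \<open>[0, l]\<close> by the inverse of that map;
    they prescribe how much of \<open>A\<close> lies to the left of the \<open>k\<close>-th
    interpolation point.\<close>
  define d where "d k = l / 2 * (1 - x k)" for k
  have x: "-1 \<le> x k" "x k \<le> 1" for k by (simp_all add: x_def)
  have d: "0 \<le> d k" "d k \<le> l" for k
    using x[of k] l mult_left_mono[of "1 - x k" 2 "l / 2"] by (simp_all add: d_def)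
  have comp: "compact A"
    using A by (meson bounded_closed_interval bounded_subset compact_eq_bounded_closed)
  have meas: "A \<inter> {s..t} \<in> lmeasurable" for s t
    using comp by (intro lmeasurable_compact compact_Int) auto
  have ne: "A \<noteq> {}" using A(3) l by auto
  have "\<forall>k. \<exists>t. t \<in> A \<and> measure lebesgue (A \<inter> {0..t}) = d k"
    by (metis measure_initial_segment_IVT[OF A(1,2) ne] d A(3) order_trans)
  then obtain t where t: "\<And>k. t k \<in> A" "\<And>k. measure lebesgue (A \<inter> {0..t k}) = d k"
    by metis
  have t0: "0 \<le> t k" "t k \<le> l + \<eta>" for k using t(1)[of k] A(2) by auto
  have lip: "d j - d k \<le> t j - t k" if "t k \<le> t j" for j k
  proof -
    have "d j \<le> measure lebesgue ((A \<inter> {0..t k}) \<union> {t k..t j})"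
      unfolding t(2)[symmetric]
      by (intro measure_mono_fmeasurable fmeasurableD meas fmeasurable.Un) auto
    also have "\<dots> \<le> d k + measure lebesgue {t k..t j}"
      unfolding t(2)[symmetric] by (intro measure_Un_le fmeasurableD meas) auto
    finally show ?thesis using that by simp
  qed
  have mono: "d k \<le> d j" if "t k \<le> t j" for j k
    unfolding t(2)[symmetric] using that
    by (intro measure_mono_fmeasurable fmeasurableD meas) auto
  have tt: "\<bar>d k - d j\<bar> \<le> \<bar>t k - t j\<bar>" for j k
    using lip[of k j] lip[of j k] mono[of k j] mono[of j k] by (cases "t k \<le> t j") auto
  \<comment> \<open>What \<open>A\<close> misses in \<open>[0, l + \<eta>]\<close> has measure at
    most \<open>\<eta>\<close>, so collapsing the gaps moves no point farther than that.\<close>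
  have far: "t k \<le> d k + \<eta>" for k
  proof -
    have "l \<le> measure lebesgue A" by fact
    also have "\<dots> \<le> measure lebesgue ((A \<inter> {0..t k}) \<union> {t k..l + \<eta>})"
      using A(2) comp by (intro measure_mono_fmeasurable fmeasurableD meas fmeasurable.Un
          lmeasurable_compact) auto
    also have "\<dots> \<le> d k + measure lebesgue {t k..l + \<eta>}"
      unfolding t(2)[symmetric] by (intro measure_Un_le fmeasurableD meas) auto
    finally show ?thesis using t0[of k] by simp
  qed
  have injx: "inj_on x {..n}" using sum_abs_lagrange_basis_cheb(2)[OF n(1) x_def] .
  have dd: "\<bar>d k - d j\<bar> = l / 2 * \<bar>x k - x j\<bar>" for j k
  proof -
    have "d k - d j = l / 2 * (x j - x k)" by (simp add: d_def field_simps)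
    then have "\<bar>d k - d j\<bar> = l / 2 * \<bar>x j - x k\<bar>" using l by (simp only: abs_mult)
    then show ?thesis by (simp only: abs_minus_commute)
  qed
  have zlow: "c * (l / 2) * \<bar>x k - x j\<bar> \<le> cmod (z (t k) - z (t j))" for k j
  proof -
    have "c * (l / 2) * \<bar>x k - x j\<bar> \<le> c * \<bar>t k - t j\<bar>"
      using tt[of k j] c unfolding dd by (simp add: mult.assoc)
    also have "\<dots> \<le> cmod (z (t k) - z (t j))" using t0 by (intro zz) auto
    finally show ?thesis .
  qed
  have zup: "cmod (z 0 - z (t j)) \<le> l / 2 * (X - x j)" for j
  proof -
    have "cmod (z 0 - z (t j)) \<le> d j + \<eta>" using z0[of "t j"] t0[of j] far[of j] by auto
    also have "\<dots> = l / 2 * (1 + 2 * \<eta> / l - x j)" using l by (simp add: d_def field_simps)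
    also have "\<dots> \<le> l / 2 * (X - x j)" using l u(2) by (simp add: X_def)
    finally show ?thesis .
  qed
  have inj: "inj_on (\<lambda>k. z (t k)) {..n}"
  proof (rule inj_onI)
    fix j k assume jk: "j \<in> {..n}" "k \<in> {..n}" "z (t j) = z (t k)"
    then have "c * (l / 2) * \<bar>x j - x k\<bar> \<le> 0" using zlow[of j k] by simp
    then have "x j = x k" using c l by (simp add: mult_le_0_iff)
    then show "j = k" using injx jk by (auto dest: inj_onD)
  qed
  have "M \<ge> 0" using order_trans[OF norm_ge_zero M[OF t(1)]] .
  \<comment> \<open>Each of the \<open>n\<close> factors costs \<open>1 / c\<close>; the scale
    \<open>l / 2\<close> cancels between \<open>zup\<close> and \<open>zlow\<close>.\<close>
  have basis: "cmod (\<Prod>j\<in>{..n}-{k}. (z 0 - z (t j)) / (z (t k) - z (t j)))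
      \<le> (1 / c) ^ n * (\<Prod>j\<in>{..n}-{k}. (X - x j) / \<bar>x k - x j\<bar>)" if k: "k \<le> n" for k
  proof -
    have "cmod (\<Prod>j\<in>{..n}-{k}. (z 0 - z (t j)) / (z (t k) - z (t j)))
      = (\<Prod>j\<in>{..n}-{k}. cmod (z 0 - z (t j)) / cmod (z (t k) - z (t j)))"
      by (simp add: norm_divide flip: prod_norm)
    also have "\<dots> \<le> (\<Prod>j\<in>{..n}-{k}. 1 / c * ((X - x j) / \<bar>x k - x j\<bar>))"
    proof (rule prod_mono, safe)
      fix j assume j: "j \<le> n" "j \<noteq> k"
      then have "x k \<noteq> x j" using injx k by (auto dest: inj_onD)
      then have pos: "0 < c * (l / 2) * \<bar>x k - x j\<bar>" using c l by simp
      have "cmod (z 0 - z (t j)) / cmod (z (t k) - z (t j))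
          \<le> (l / 2 * (X - x j)) / (c * (l / 2) * \<bar>x k - x j\<bar>)"
        by (rule frac_le[OF order_trans[OF norm_ge_zero zup] zup pos zlow])
      also have "\<dots> = 1 / c * ((X - x j) / \<bar>x k - x j\<bar>)" using l by simp
      finally show "cmod (z 0 - z (t j)) / cmod (z (t k) - z (t j))
          \<le> 1 / c * ((X - x j) / \<bar>x k - x j\<bar>)" .
    qed simp
    also have "\<dots> = (\<Prod>j\<in>{..n}-{k}. 1 / c) * (\<Prod>j\<in>{..n}-{k}. (X - x j) / \<bar>x k - x j\<bar>)"
      by (rule prod.distrib)
    also have "(\<Prod>j\<in>{..n}-{k}. 1 / c) = (1 / c) ^ n" using k by simp
    finally show ?thesis .
  qed
  have "cmod (poly q (z 0)) = cmod (\<Sum>k\<le>n. poly q (z (t k)) *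
      (\<Prod>j\<in>{..n}-{k}. (z 0 - z (t j)) / (z (t k) - z (t j))))"
    using lagrange_interpolation[OF n(2) inj, of "z 0"] by simp
  also have "\<dots> \<le> (\<Sum>k\<le>n. M * ((1 / c) ^ n * (\<Prod>j\<in>{..n}-{k}. (X - x j) / \<bar>x k - x j\<bar>)))"
  proof (rule order_trans[OF norm_sum sum_mono])
    fix k assume "k \<in> {..n}"
    then show "cmod (poly q (z (t k)) * (\<Prod>j\<in>{..n}-{k}. (z 0 - z (t j)) / (z (t k) - z (t j))))
        \<le> M * ((1 / c) ^ n * (\<Prod>j\<in>{..n}-{k}. (X - x j) / \<bar>x k - x j\<bar>))"
      unfolding norm_mult using \<open>M \<ge> 0\<close> by (intro mult_mono M[OF t(1)] basis) auto
  qed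
  also have "\<dots> = M * (1 / c) ^ n * poly (cheb_poly n) X"
    unfolding sum_abs_lagrange_basis_cheb(1)[OF n(1) x_def, symmetric] sum_distrib_left mult.assoc ..
  also have "\<dots> \<le> M * (1 / c) ^ n * u ^ n"
  proof (intro mult_left_mono)
    have "1 \<le> u ^ n" using u(1) by simp
    then have le: "1 / u ^ n \<le> u ^ n" using order_trans[of "1 / u ^ n" 1] by simp
    have "poly (cheb_poly n) X = (u ^ n + 1 / u ^ n) / 2"
      unfolding X_def using u(1) by (intro poly_cheb_poly_joukowski) simp
    also have "\<dots> \<le> (u ^ n + u ^ n) / 2" by (intro divide_right_mono add_left_mono le) simp
    finally show "poly (cheb_poly n) X \<le> u ^ n" by simp
  qed (use \<open>M \<ge> 0\<close> c in auto)
  also have "\<dots> = M * (u / c) ^ n" by (simp add: power_divide power_one_over)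
  finally show ?thesis .
qed

section \<open>From endpoints to arcs: chords and angles\<close>

lemma cmod_cis_diff: "cmod (cis s - cis t) = 2 * \<bar>sin ((s - t) / 2)\<bar>"
proof -
  have "(cmod (cis s - cis t))\<^sup>2 = 2 - 2 * cos (s - t)"
    using sin_cos_squared_add[of s] sin_cos_squared_add[of t]
    by (simp add: cmod_power2 power2_diff cos_diff algebra_simps)
  also have "cos (s - t) = 1 - 2 * (sin ((s - t) / 2))\<^sup>2"
    using cos_double_sin[of "(s - t) / 2"] by (simp only: times_divide_eq_right nonzero_mult_div_cancel_left zero_neq_numeral not_False_eq_True)
  also have "2 - 2 * (1 - 2 * (sin ((s - t) / 2))\<^sup>2) = (2 * sin ((s - t) / 2))\<^sup>2"
    by (simp add: power_mult_distrib)
  finally have "cmod (cis s - cis t) = \<bar>2 * sin ((s - t) / 2)\<bar>"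
    by (metis norm_ge_zero real_sqrt_abs real_sqrt_unique)
  then show ?thesis by (simp add: abs_mult)
qed

text \<open>The ratio of chord to angle tends to 1 because \<open>sin x / x\<close> does.\<close>

lemma cis_locally_expanding:
  assumes "c < 1"
  obtains L where "L > 0" "\<And>s t. \<bar>s - t\<bar> \<le> L \<Longrightarrow> c * \<bar>s - t\<bar> \<le> cmod (cis s - cis t)"
proof -
  have "((\<lambda>x. sin x / x) \<longlongrightarrow> (1::real)) (at 0)"
    using DERIV_sin[of "0::real"] by (simp add: has_field_derivative_iff)
  then have "\<forall>\<^sub>F x in at 0. c < sin x / (x::real)"
    using assms by (rule order_tendstoD)
  then obtain e where e: "e > 0" "\<And>x::real. x \<noteq> 0 \<Longrightarrow> dist x 0 < e \<Longrightarrow> c < sin x / x"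
    unfolding eventually_at by auto
  show thesis
  proof
    show "e > 0" by fact
    fix s t :: real assume st: "\<bar>s - t\<bar> \<le> e"
    show "c * \<bar>s - t\<bar> \<le> cmod (cis s - cis t)"
    proof (cases "s = t")
      case False
      define x where "x = (s - t) / 2"
      have x: "x \<noteq> 0" "dist x 0 < e" using st False e(1) by (auto simp: x_def)
      then have "c < \<bar>sin x\<bar> / \<bar>x\<bar>"
        using e(2)[OF x] abs_ge_self[of "sin x / x"] by (simp add: abs_divide)
      then have "c * \<bar>x\<bar> \<le> \<bar>sin x\<bar>" using x(1) by (simp add: field_simps)
      then show ?thesis unfolding cmod_cis_diff x_def by simp
    qed simp
  qed
qed

text \<open>Each \<open>t\<close> is an end of a short window inside \<open>[a, b]\<close>, to which
  \<open>remez_endpoint\<close> applies. It matters that \<open>\<eta>\<close> is independent of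
  \<open>n\<close>, \<open>q\<close> and \<open>t\<close>.\<close>

lemma remez_cis:
  fixes a b C :: real
  assumes "a < b" "C > 1"
  obtains \<eta> where "\<eta> > 0"
    and "\<And>K n q M t. \<lbrakk>closed K; K \<subseteq> {a..b}; measure lebesgue K \<ge> b - a - \<eta>; n > 0; degree q \<le> n;
      \<And>s. s \<in> K \<Longrightarrow> cmod (poly q (cis s)) \<le> M; t \<in> {a..b}\<rbrakk>
      \<Longrightarrow> cmod (poly q (cis t)) \<le> M * C ^ n"
proof -
  \<comment> \<open>\<open>C\<close> is split evenly: one factor \<open>u\<close> for the Chebyshev
    growth, one for the loss from angle to chord.\<close>
  define u where "u = sqrt C"
  define X where "X = (u + 1 / u) / 2"
  have u: "u > 1" using assms by (simp add: u_def)
  have "0 < (u - 1)\<^sup>2 / (2 * u)" using u by simp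
  also have "\<dots> = X - 1" using u by (simp add: X_def field_simps power2_eq_square)
  finally have X: "X > 1" by simp
  have "1 / u < 1" using u by simp
  then obtain L0 where L0: "L0 > 0"
      "\<And>s t. \<bar>s - t\<bar> \<le> L0 \<Longrightarrow> 1 / u * \<bar>s - t\<bar> \<le> cmod (cis s - cis t)"
    using cis_locally_expanding by blast
  define L where "L = min L0 ((b - a) / 2)"
  have L: "L > 0" "L \<le> L0" "L \<le> (b - a) / 2" using L0 assms by (auto simp: L_def min_def)
  \<comment> \<open>With \<open>\<eta> = \<kappa> * l\<close> this makes
    \<open>1 + 2 * \<eta> / l\<close> equal to \<open>X\<close>; \<open>l\<close> is then fixed by
    \<open>l + \<eta> = L\<close>.\<close>
  define \<kappa> where "\<kappa> = (X - 1) / 2"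
  have \<kappa>: "\<kappa> > 0" using X by (simp add: \<kappa>_def)
  define l where "l = L / (1 + \<kappa>)"
  define \<eta> where "\<eta> = \<kappa> * l"
  have l: "l > 0" using L \<kappa> by (simp add: l_def)
  have \<eta>: "\<eta> > 0" using l \<kappa> by (simp add: \<eta>_def)
  have "L = l * (1 + \<kappa>)" using \<kappa> by (simp add: l_def)
  then have lL: "l + \<eta> = L" by (simp add: \<eta>_def algebra_simps)
  have lX: "1 + 2 * \<eta> / l = X" using l by (simp add: \<eta>_def \<kappa>_def)
  show thesis
  proof
    show "\<eta> > 0" by fact
    fix K :: "real set" and n and q :: "complex poly" and M x
    assume K: "closed K" "K \<subseteq> {a..b}" "measure lebesgue K \<ge> b - a - \<eta>"
      and n: "n > 0" "degree q \<le> n"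
      and M: "\<And>s. s \<in> K \<Longrightarrow> cmod (poly q (cis s)) \<le> M" and x: "x \<in> {a..b}"
    \<comment> \<open>The direction of the window starting at \<open>x\<close>; one of the two fits
      since \<open>L\<close> is at most half the length of \<open>[a, b]\<close>.\<close>
    obtain \<sigma> :: real where \<sigma>: "\<bar>\<sigma>\<bar> = 1" "{x + \<sigma> * L, x} \<subseteq> {a..b}"
    proof (cases "x + L \<le> b")
      case True
      then show ?thesis using that[of 1] x L by auto
    next
      case False
      then show ?thesis using that[of "-1"] x L by auto
    qed
    define A where "A = {0..L} \<inter> (\<lambda>t. x + \<sigma> * t) -` K"
    define J where "J = (\<lambda>t. \<sigma> *\<^sub>R t + x) ` {0..L}"
    have "closed A"
      unfolding A_def by (intro closed_Int closed_vimage K continuous_intros)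
    have J: "J \<subseteq> {a..b}" "measure lebesgue J = L" "compact J"
    proof -
      show "J \<subseteq> {a..b}"
        using \<sigma> by (cases "\<sigma> = 1") (auto simp: J_def abs_if split: if_splits)
      show "measure lebesgue J = L"
        unfolding J_def measure_lebesgue_affine using \<sigma> L by simp
      show "compact J"
        unfolding J_def by (intro compact_continuous_image continuous_intros) auto
    qed
    have compK: "compact K"
      using K by (meson bounded_closed_interval bounded_subset compact_eq_bounded_closed)
    have "measure lebesgue A = measure lebesgue ((\<lambda>t. \<sigma> *\<^sub>R t + x) ` A)"
      unfolding measure_lebesgue_affine using \<sigma> by simp
    also have "(\<lambda>t. \<sigma> *\<^sub>R t + x) ` A = K \<inter> J"
      by (auto simp: A_def J_def add.commute)
    finally have mA: "measure lebesgue A = measure lebesgue (K \<inter> J)" .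
    have lm: "K \<inter> J \<in> lmeasurable" "J \<in> lmeasurable" "{a..b} \<in> lmeasurable"
      using compK J by (auto intro: lmeasurable_compact)
    \<comment> \<open>Even if all that \<open>K\<close> misses lies in the window \<open>J\<close>,
      measure at least \<open>L - \<eta> = l\<close> remains there.\<close>
    have "measure lebesgue K \<le> measure lebesgue ((K \<inter> J) \<union> ({a..b} - J))"
      using K by (intro measure_mono_fmeasurable fmeasurable.Un[OF lm(1)] fmeasurable.Diff
          fmeasurableD[OF lmeasurable_compact[OF compK]] lm(2,3)) auto
    also have "\<dots> \<le> measure lebesgue (K \<inter> J) + measure lebesgue ({a..b} - J)"
      using lm by (intro measure_Un_le fmeasurableD) (auto intro: fmeasurable.Diff)
    also have "measure lebesgue ({a..b} - J) = (b - a) - L"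
      using lm J assms by (subst measurable_measure_Diff) auto
    finally have "l \<le> measure lebesgue A" using K(3) lL mA by simp
    have "cmod (poly q (cis (x + \<sigma> * 0))) \<le> M * (u / (1 / u)) ^ n"
    proof (rule remez_endpoint[where A = A and l = l and \<eta> = \<eta>])
      show "cmod (cis (x + \<sigma> * 0) - cis (x + \<sigma> * t)) \<le> t" if "t \<in> {0..l + \<eta>}" for t
      proof -
        have "2 * \<bar>sin ((x - (x + \<sigma> * t)) / 2)\<bar> \<le> 2 * \<bar>(x - (x + \<sigma> * t)) / 2\<bar>"
          by (intro mult_left_mono abs_sin_x_le_abs_x) simp
        then show ?thesis using \<sigma> that by (simp add: cmod_cis_diff abs_mult)
      qed
      show "1 / u * \<bar>s - t\<bar> \<le> cmod (cis (x + \<sigma> * s) - cis (x + \<sigma> * t))"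
        if "s \<in> {0..l + \<eta>}" "t \<in> {0..l + \<eta>}" for s t
      proof -
        have "\<bar>(x + \<sigma> * s) - (x + \<sigma> * t)\<bar> = \<bar>\<sigma>\<bar> * \<bar>s - t\<bar>"
          by (simp flip: abs_mult add: algebra_simps)
        then have *: "\<bar>(x + \<sigma> * s) - (x + \<sigma> * t)\<bar> = \<bar>s - t\<bar>" using \<sigma> by simp
        then have "\<bar>(x + \<sigma> * s) - (x + \<sigma> * t)\<bar> \<le> L0"
          using that L lL by auto
        from L0(2)[OF this] show ?thesis unfolding * .
      qed
    qed (use \<open>closed A\<close> \<open>l \<le> _\<close> l \<eta> u lX lL n M in \<open>auto simp: A_def X_def\<close>)
    also have "u / (1 / u) = C" using assms by (simp add: u_def)
    finally show "cmod (poly q (cis x)) \<le> M * C ^ n" by simp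
  qed
qed

section \<open>Supremum bounds from weighted square means\<close>

text \<open>The sets where \<open>f\<close> is at least \<open>1 / (m + 1)\<close> increase to a set
  containing the open interval, so one of them misses less than \<open>\<eta> / 2\<close>; inner
  regularity by closed sets costs another \<open>\<eta> / 2\<close>.\<close>

lemma closed_superlevel_subset:
  fixes f :: "real \<Rightarrow> real"
  assumes f: "f \<in> borel_measurable (lebesgue_on {a..b})" and pos: "\<And>t. t \<in> {a<..<b} \<Longrightarrow> f t > 0"
    and "a < b" "\<eta> > 0"
  obtains K \<delta> where "closed K" "K \<subseteq> {a..b}" "measure lebesgue K \<ge> b - a - \<eta>"
    "\<delta> > 0" "\<And>t. t \<in> K \<Longrightarrow> f t \<ge> \<delta>"
proof -
  define S where "S m = {t \<in> {a..b}. f t \<ge> 1 / real (Suc m)}" for m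
  have S: "S m \<in> sets lebesgue" for m
  proof -
    have "{t \<in> space (lebesgue_on {a..b}). 1 / real (Suc m) \<le> f t} \<in> sets (lebesgue_on {a..b})"
      using f by measurable
    then show ?thesis
      by (auto simp: S_def space_restrict_space sets_restrict_space_iff)
  qed
  have inc: "incseq S"
  proof (intro incseq_SucI subsetI)
    fix m t assume "t \<in> S m"
    moreover have "1 / real (Suc (Suc m)) \<le> 1 / real (Suc m)" by (intro divide_left_mono) auto
    ultimately show "t \<in> S (Suc m)" unfolding S_def by auto
  qed
  have UN: "(\<Union>m. S m) \<in> lmeasurable"
  proof (rule bounded_set_imp_lmeasurable)
    show "bounded (\<Union>m. S m)"
      by (rule bounded_subset[OF bounded_closed_interval[of a b]]) (auto simp: S_def)
    show "(\<Union>m. S m) \<in> sets lebesgue"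
      using S by (intro sets.countable_UN) auto
  qed
  have "{a<..<b} \<subseteq> (\<Union>m. S m)"
  proof
    fix t assume t: "t \<in> {a<..<b}"
    then obtain m where "inverse (real (Suc m)) < f t" using pos reals_Archimedean by blast
    then show "t \<in> (\<Union>m. S m)" using t by (auto simp: S_def inverse_eq_divide intro!: exI[of _ m])
  qed
  then have "measure lebesgue {a<..<b} \<le> measure lebesgue (\<Union>m. S m)"
    using UN by (intro measure_mono_fmeasurable) auto
  then have ge: "b - a - \<eta> / 2 < measure lebesgue (\<Union>m. S m)" using assms by simp
  have "(\<lambda>m. measure lebesgue (S m)) \<longlonglongrightarrow> measure lebesgue (\<Union>m. S m)"
    using S inc UN by (intro Lim_measure_incseq) (auto dest: fmeasurableD2)
  then have "\<forall>\<^sub>F m in sequentially. b - a - \<eta> / 2 < measure lebesgue (S m)"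
    using ge by (rule order_tendstoD)
  then obtain m where m: "b - a - \<eta> / 2 < measure lebesgue (S m)"
    using eventually_happens'[OF sequentially_bot] by blast
  obtain K where K: "closed K" "K \<subseteq> S m" "S m - K \<in> lmeasurable"
      "emeasure lebesgue (S m - K) < ennreal (\<eta> / 2)"
    using sets_lebesgue_inner_closed[OF S, of "\<eta> / 2" m] assms by auto
  have "measure lebesgue (S m - K) < \<eta> / 2"
    using K(3,4) by (simp add: emeasure_eq_measure2 ennreal_less_iff)
  moreover have "measure lebesgue (S m) \<le> measure lebesgue K + measure lebesgue (S m - K)"
  proof -
    have "S m = K \<union> (S m - K)" using K by auto
    then show ?thesis using K S by (metis borel_closed measure_Un_le fmeasurableD sets_completionI_sets sets_lborel)
  qed
  ultimately have "measure lebesgue K \<ge> b - a - \<eta>" using m by simp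
  moreover have "K \<subseteq> {a..b}" "\<And>t. t \<in> K \<Longrightarrow> f t \<ge> 1 / Suc m"
    using K(2) by (auto simp: S_def)
  ultimately show thesis using K(1) by (intro that[of K "1 / Suc m"]) auto
qed

text \<open>Nonnegativity upgrades gauge integrability of \<open>f\<close> to absolute
  integrability, which survives multiplication by a bounded measurable function.\<close>

lemma integrable_weighted_poly:
  assumes "\<And>l. l \<in> {-pi..pi} \<Longrightarrow> f l \<ge> 0" and "f integrable_on {-pi..pi}"
  shows "(\<lambda>l. (cmod (poly q (cis l)))\<^sup>2 * f l) integrable_on {-pi..pi}"
proof -
  have cont: "continuous_on {-pi..pi} (\<lambda>l. (cmod (poly q (cis l)))\<^sup>2)"
    by (intro continuous_intros)
  have "(\<lambda>l. (cmod (poly q (cis l)))\<^sup>2 * f l) absolutely_integrable_on {-pi..pi}"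
  proof (rule absolutely_integrable_bounded_measurable_product_real)
    show "f absolutely_integrable_on {-pi..pi}"
      using assms by (intro nonnegative_absolutely_integrable_1) auto
    show "bounded ((\<lambda>l. (cmod (poly q (cis l)))\<^sup>2) ` {-pi..pi})"
      by (intro compact_imp_bounded compact_continuous_image cont) auto
  qed (use cont in \<open>auto intro: continuous_imp_measurable_on_sets_lebesgue\<close>)
  then show ?thesis by (rule set_lebesgue_integral_eq_integral(1))
qed

text \<open>Chebyshev's inequality bounds \<open>q\<close> on most of a set where \<open>f\<close>
  is bounded below, and the Remez inequality does the rest. The strict bound \<open>s\<close> is
  positive even if the integral vanishes, and \<open>B\<close> depends on neither \<open>n\<close>
  nor \<open>q\<close>.\<close>

lemma sup_bound_on_interval:
  fixes f :: "real \<Rightarrow> real"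
  assumes f: "\<And>l. l \<in> {-pi..pi} \<Longrightarrow> f l \<ge> 0" "f integrable_on {-pi..pi}"
    and ab: "a < b" "{a..b} \<subseteq> {-pi..pi}" and pos: "\<And>t. t \<in> {a<..<b} \<Longrightarrow> f t > 0"
    and C: "C > 1"
  obtains B where "B > 0"
    and "\<And>n q s t. \<lbrakk>n > 0; degree q \<le> n; s > integral {-pi..pi} (\<lambda>l. (cmod (poly q (cis l)))\<^sup>2 * f l);
      t \<in> {a..b}\<rbrakk> \<Longrightarrow> cmod (poly q (cis t)) \<le> B * C ^ n * sqrt s"
proof -
  obtain \<eta> where \<eta>: "\<eta> > 0" and
    remez: "\<And>K n q M t. \<lbrakk>closed K; K \<subseteq> {a..b}; measure lebesgue K \<ge> b - a - \<eta>; n > 0; degree q \<le> n;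
      \<And>s. s \<in> K \<Longrightarrow> cmod (poly q (cis s)) \<le> M; t \<in> {a..b}\<rbrakk>
      \<Longrightarrow> cmod (poly q (cis t)) \<le> M * C ^ n"
    using remez_cis[OF ab(1) C] by blast
  have "f absolutely_integrable_on {-pi..pi}"
    using f by (intro nonnegative_absolutely_integrable_1) auto
  then have "f \<in> borel_measurable (lebesgue_on {-pi..pi})"
    by (intro absolutely_integrable_imp_borel_measurable) auto
  then have fm: "f \<in> borel_measurable (lebesgue_on {a..b})"
    by (rule measurable_restrict_mono) (rule ab(2))
  obtain K \<delta> where K: "closed K" "K \<subseteq> {a..b}" "measure lebesgue K \<ge> b - a - \<eta> / 2"
    "\<delta> > 0" "\<And>t. t \<in> K \<Longrightarrow> f t \<ge> \<delta>"
    using closed_superlevel_subset[OF fm pos ab(1) half_gt_zero[OF \<eta>]] by blast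
  show thesis
  proof
    show "sqrt (2 / (\<delta> * \<eta>)) > 0" using K \<eta> by simp
    fix n q s t
    assume n: "n > 0" "degree q \<le> n" and t: "t \<in> {a..b}"
      and s: "s > integral {-pi..pi} (\<lambda>l. (cmod (poly q (cis l)))\<^sup>2 * f l)"
    have int: "(\<lambda>l. (cmod (poly q (cis l)))\<^sup>2 * f l) integrable_on {-pi..pi}"
      using integrable_weighted_poly[OF f] .
    have "0 \<le> integral {-pi..pi} (\<lambda>l. (cmod (poly q (cis l)))\<^sup>2 * f l)"
      using int f by (intro integral_nonneg) auto
    then have "s > 0" using s by simp
    \<comment> \<open>Chosen so that \<open>s / (M\<^sup>2 * \<delta>) = \<eta> / 2\<close>: the
      exceptional set \<open>W\<close> then uses up the half of \<open>\<eta>\<close> not already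
      spent on \<open>K\<close>.\<close>
    define M where "M = sqrt (2 / (\<delta> * \<eta>)) * sqrt s"
    have M2: "M\<^sup>2 = 2 * s / (\<delta> * \<eta>)" using K \<eta> \<open>s > 0\<close> by (simp add: M_def power_mult_distrib)
    have "M \<ge> 0" using K \<eta> \<open>s > 0\<close> by (simp add: M_def)
    define K' where "K' = K \<inter> {l. cmod (poly q (cis l)) \<le> M}"
    have "closed K'"
      unfolding K'_def by (intro closed_Int K closed_Collect_le continuous_intros)
    have compact: "compact K" "compact K'"
      using K(1,2) \<open>closed K'\<close> bounded_subset[OF bounded_closed_interval[of a b]]
      by (auto simp: K'_def compact_eq_bounded_closed)
    define W where "W = K - K'"
    have "W \<in> lmeasurable"
      unfolding W_def by (intro fmeasurable.Diff fmeasurableD lmeasurable_compact compact)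
    moreover have "W \<inter> {-pi..pi} = W"
      using K ab by (auto simp: W_def)
    ultimately have W: "W \<inter> {-pi..pi} = W" "W \<inter> {-pi..pi} \<in> lmeasurable" by simp_all
    have "M\<^sup>2 * \<delta> * measure lebesgue W = integral {-pi..pi} (\<lambda>l. M\<^sup>2 * \<delta> * indicator W l)"
      using W by (simp add: integral_indicator)
    also have "\<dots> \<le> integral {-pi..pi} (\<lambda>l. (cmod (poly q (cis l)))\<^sup>2 * f l)"
    proof (rule integral_le)
      show "(\<lambda>l. M\<^sup>2 * \<delta> * indicator W l) integrable_on {-pi..pi}"
        using W by (intro integrable_on_mult_right) (simp add: integrable_on_indicator)
      show "(\<lambda>l. (cmod (poly q (cis l)))\<^sup>2 * f l) integrable_on {-pi..pi}" by fact
      show "M\<^sup>2 * \<delta> * indicator W l \<le> (cmod (poly q (cis l)))\<^sup>2 * f l" if "l \<in> {-pi..pi}" for l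
        using f(1)[OF that] K(4,5) \<open>M \<ge> 0\<close>
        by (auto simp: indicator_def W_def K'_def intro!: mult_mono power_mono)
    qed
    also have "\<dots> \<le> s" using s by simp
    finally have "measure lebesgue W \<le> \<eta> / 2"
      unfolding M2 using K \<eta> \<open>s > 0\<close> by (simp add: field_simps)
    moreover have "measure lebesgue W = measure lebesgue K - measure lebesgue K'"
      unfolding W_def using compact
      by (intro measurable_measure_Diff) (auto simp: K'_def intro: lmeasurable_compact fmeasurableD)
    ultimately have "measure lebesgue K' \<ge> b - a - \<eta>" using K by simp
    then have "cmod (poly q (cis t)) \<le> M * C ^ n"
      using \<open>closed K'\<close> K n t by (intro remez[of K']) (auto simp: K'_def)
    then show "cmod (poly q (cis t)) \<le> sqrt (2 / (\<delta> * \<eta>)) * C ^ n * sqrt s"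
      by (simp add: M_def mult_ac)
  qed
qed

section \<open>The generalized Chebyshev constant\<close>

lemma one_in_Qn1: "1 \<in> Qn1 n"
  by (simp add: Qn1_def)

text \<open>\<open>F\<close> may be an open arc, so compactness is taken from its closure.\<close>

lemma bdd_above_cmod_poly:
  assumes "bounded F"
  shows "bdd_above ((\<lambda>z. cmod (poly q z)) ` F)"
proof -
  have "compact ((\<lambda>z. cmod (poly q z)) ` closure F)"
    using assms by (intro compact_continuous_image continuous_intros) simp
  then have "bdd_above ((\<lambda>z. cmod (poly q z)) ` closure F)"
    by (intro bounded_imp_bdd_above compact_imp_bounded)
  then show ?thesis
    by (rule bdd_above_mono) (intro image_mono closure_subset)
qed

lemma cmod_poly_le_SUP:
  assumes "bounded F" "z \<in> F"
  shows "cmod (poly q z) \<le> (SUP z\<in>F. cmod (poly q z))"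
  using assms by (intro cSUP_upper bdd_above_cmod_poly)

lemma SUP_cmod_poly_nonneg:
  assumes "bounded F" "F \<noteq> {}"
  shows "0 \<le> (SUP z\<in>F. cmod (poly q z))"
proof -
  obtain z where "z \<in> F" using assms by blast
  show ?thesis using order_trans[OF norm_ge_zero cmod_poly_le_SUP[OF assms(1) \<open>z \<in> F\<close>]] .
qed

lemma m_tilde_le:
  assumes "bounded F" "F \<noteq> {}" "q \<in> Qn1 n" and c: "\<And>z. z \<in> F \<Longrightarrow> cmod (poly q z) \<le> c"
  shows "m_tilde n F \<le> c"
proof -
  have "m_tilde n F \<le> (SUP z\<in>F. cmod (poly q z))"
    unfolding m_tilde_def using assms(3) SUP_cmod_poly_nonneg[OF assms(1,2)]
    by (intro cInf_lower bdd_belowI2[where m = 0]) auto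
  also have "\<dots> \<le> c" using assms by (intro cSUP_least)
  finally show ?thesis .
qed

lemma m_tilde_ge:
  assumes "\<And>q. q \<in> Qn1 n \<Longrightarrow> c \<le> (SUP z\<in>F. cmod (poly q z))"
  shows "c \<le> m_tilde n F"
  unfolding m_tilde_def using assms one_in_Qn1 by (intro cInf_greatest) auto

lemma m_tilde_nonneg:
  assumes "bounded F" "F \<noteq> {}"
  shows "0 \<le> m_tilde n F"
  using SUP_cmod_poly_nonneg[OF assms] by (rule m_tilde_ge)

lemma m_tilde_le_1:
  assumes "bounded F" "F \<noteq> {}"
  shows "m_tilde n F \<le> 1"
  using assms one_in_Qn1 by (rule m_tilde_le) simp

text \<open>Powers of a near-optimal polynomial keep the normalisation at 1. This replaces
  submultiplicativity and avoids the existence of minimisers.\<close>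

lemma m_tilde_less_imp_power_le:
  assumes F: "bounded F" "F \<noteq> {}" and "m_tilde k F < c"
  shows "m_tilde n F \<le> c ^ (n div k)"
proof -
  obtain q where q: "q \<in> Qn1 k" "(SUP z\<in>F. cmod (poly q z)) < c"
    using assms(3) one_in_Qn1 unfolding m_tilde_def by (auto dest!: cInf_lessD[rotated])
  have "degree (q ^ (n div k)) \<le> degree q * (n div k)"
    by (rule degree_power_le)
  also have "\<dots> \<le> k * (n div k)" using q by (auto simp: Qn1_def)
  also have "\<dots> \<le> n" by simp
  finally have "q ^ (n div k) \<in> Qn1 n" using q by (simp add: Qn1_def)
  then show ?thesis
  proof (rule m_tilde_le[OF F])
    fix z assume "z \<in> F"
    then have "cmod (poly q z) \<le> c"
      by (rule order_trans[OF cmod_poly_le_SUP[OF F(1)] less_imp_le[OF q(2)]])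
    then show "cmod (poly (q ^ (n div k)) z) \<le> c ^ (n div k)"
      by (simp add: norm_power power_mono)
  qed
qed

text \<open>As in Fekete's lemma, the limit is the infimum of the roots over positive
  indices.\<close>

lemma m_tilde_root_convergent:
  assumes F: "bounded F" "F \<noteq> {}"
  shows "convergent (\<lambda>n. root n (m_tilde n F))"
proof -
  \<comment> \<open>Index 0 is left out, as \<open>root 0\<close> is constantly 0.\<close>
  define L where "L = (INF k. root (Suc k) (m_tilde (Suc k) F))"
  have nn: "0 \<le> root n (m_tilde n F)" for n
    using m_tilde_nonneg[OF F] by (cases "n = 0") auto
  have lower: "L \<le> root n (m_tilde n F)" if "n > 0" for n
  proof -
    have "L \<le> root (Suc (n - 1)) (m_tilde (Suc (n - 1)) F)"
      unfolding L_def using nn by (intro cINF_lower bdd_belowI2[where m = 0]) auto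
    then show ?thesis using that by simp
  qed
  have "0 \<le> L" unfolding L_def using nn by (intro cINF_greatest) auto
  have "(\<lambda>n. root n (m_tilde n F)) \<longlonglongrightarrow> L"
  proof (rule order_tendstoI)
    fix a assume "a < L"
    show "\<forall>\<^sub>F n in sequentially. a < root n (m_tilde n F)"
      using eventually_gt_at_top[of "0::nat"]
      by eventually_elim (rule less_le_trans[OF \<open>a < L\<close> lower])
  next
    fix a assume "L < a"
    then obtain r where r: "L < r" "r < a" using dense by blast
    then have "r > 0" using \<open>0 \<le> L\<close> by simp
    obtain k where k: "root k (m_tilde k F) < r" "k > 0"
    proof -
      have "\<exists>k. root (Suc k) (m_tilde (Suc k) F) < r"
        using r(1) unfolding L_def by (subst (asm) cINF_less_iff) (auto intro: bdd_belowI2[where m = 0] nn)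
      then show ?thesis using that by blast
    qed
    have "m_tilde k F = root k (m_tilde k F) ^ k"
      using k m_tilde_nonneg[OF F] by simp
    also have "\<dots> < r ^ k" using k nn by (intro power_strict_mono) auto
    finally have mk: "m_tilde k F < r ^ k" .
    \<comment> \<open>Bounds the correction \<open>(1 / r) ^ (n mod k)\<close> from dividing
      \<open>n\<close> by \<open>k\<close> with remainder, whether \<open>r\<close> is above or
      below 1; its \<open>n\<close>-th root tends to 1.\<close>
    define D where "D = 1 + (1 / r) ^ k"
    have "D > 0" using \<open>r > 0\<close> by (simp add: D_def add_pos_nonneg)
    have D: "(1 / r) ^ j \<le> D" if "j \<le> k" for j
    proof (cases "1 / r \<le> 1")
      case True
      then have "(1 / r) ^ j \<le> 1" using \<open>r > 0\<close> by (intro power_le_one) auto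
      then show ?thesis using \<open>r > 0\<close> by (simp add: D_def add_increasing2)
    next
      case False
      then have "(1 / r) ^ j \<le> (1 / r) ^ k" using that by (intro power_increasing) auto
      then show ?thesis by (simp add: D_def)
    qed
    have upper: "root n (m_tilde n F) \<le> r * root n D" if "n > 0" for n
    proof -
      have "m_tilde n F \<le> (r ^ k) ^ (n div k)"
        using m_tilde_less_imp_power_le[OF F mk] .
      also have "\<dots> = r ^ (k * (n div k))" by (simp add: power_mult)
      also have "\<dots> = r ^ (k * (n div k)) * r ^ (n mod k) * (1 / r) ^ (n mod k)"
        using \<open>r > 0\<close> by (simp add: power_divide)
      also have "r ^ (k * (n div k)) * r ^ (n mod k) = r ^ n"
        by (simp flip: power_add)
      also have "r ^ n * (1 / r) ^ (n mod k) \<le> r ^ n * D"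
        using \<open>r > 0\<close> k by (intro mult_left_mono D) auto
      finally have "root n (m_tilde n F) \<le> root n (r ^ n * D)" using that by simp
      also have "\<dots> = r * root n D"
        using that \<open>r > 0\<close> by (simp add: real_root_mult real_root_power_cancel)
      finally show ?thesis .
    qed
    have "(\<lambda>n. r * root n D) \<longlonglongrightarrow> r * 1"
      using \<open>D > 0\<close> by (intro tendsto_intros LIMSEQ_root_const)
    then have "\<forall>\<^sub>F n in sequentially. r * root n D < a"
      using r by (intro order_tendstoD(2)) auto
    then show "\<forall>\<^sub>F n in sequentially. root n (m_tilde n F) < a"
      using eventually_gt_at_top[of "0::nat"] by eventually_elim (rule le_less_trans[OF upper])
  qed
  then show ?thesis by (rule convergentI)
qed

lemma tau_tilde_LIMSEQ:
  assumes "bounded F" "F \<noteq> {}"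
  shows "(\<lambda>n. root n (m_tilde n F)) \<longlonglongrightarrow> tau_tilde F"
  using m_tilde_root_convergent[OF assms] unfolding tau_tilde_def convergent_LIMSEQ_iff .

lemma tau_tilde_le_1:
  assumes "bounded F" "F \<noteq> {}"
  shows "tau_tilde F \<le> 1"
proof (rule LIMSEQ_le_const2[OF tau_tilde_LIMSEQ[OF assms]], intro exI allI impI)
  fix n :: nat assume "n \<ge> 1"
  then show "root n (m_tilde n F) \<le> 1" using m_tilde_le_1[OF assms] by simp
qed

section \<open>Comparison of the two rates\<close>

lemma cis_shift: "cis (t + 2 * pi * of_int k) = cis t"
proof -
  have "cis (2 * pi * of_int k) = 1" by (rule cis_multiple_2pi) simp
  then show ?thesis unfolding cis_mult[symmetric] by simp
qed

text \<open>Membership only gives positivity at some preimage in \<open>[-pi, pi]\<close>. An angle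
  in the open interval is its own only preimage, whereas \<open>-pi\<close> and \<open>pi\<close>
  share the point \<open>-1\<close>.\<close>

lemma E_set_pos:
  assumes l: "l \<in> {-pi<..<pi}" "cis l \<in> E_set f"
  shows "f l > 0"
proof -
  from l(2) obtain l' where l': "l' \<in> {-pi..pi}" "f l' > 0" "cis l = cis l'"
    unfolding E_set_def by blast
  have "Arg (cis l) = l" using l by (intro cis_Arg_unique) auto
  have "l' \<noteq> -pi"
  proof
    assume "l' = -pi"
    then have "cis l = -1" using l' cis_cnj[of pi] by simp
    moreover have "Arg (-1) = pi" by (rule cis_Arg_unique) auto
    ultimately show False using \<open>Arg (cis l) = l\<close> l by simp
  qed
  then have "Arg (cis l') = l'" using l'(1) by (intro cis_Arg_unique) auto
  then show ?thesis using \<open>Arg (cis l) = l\<close> l' by simp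
qed

text \<open>Full length \<open>2 * pi\<close> is allowed for an arc, so the case of the whole circle
  reduces to that of an arc.\<close>

lemma is_arc_sphere: "is_arc (sphere 0 1)"
  unfolding is_arc_def
proof (intro exI conjI)
  show "sphere 0 1 \<subseteq> cis ` {-pi..pi}"
  proof
    fix z :: complex assume "z \<in> sphere 0 1"
    then have "cmod z = 1" "z \<noteq> 0" by auto
    then have "z = cis (Arg z)" by (simp add: cis_Arg sgn_div_norm)
    then show "z \<in> cis ` {-pi..pi}" using Arg_bounded[of z] by (intro image_eqI[of _ _ "Arg z"]) auto
  qed
qed auto

text \<open>The cut of the parametrisation at \<open>-1\<close> may break the arc into two pieces.\<close>
lemma arc_E_set_cover:
  assumes "is_arc (E_set f)"
  obtains a1 b1 a2 b2 where "a1 < b1" "{a1..b1} \<subseteq> {-pi..pi}" "\<And>t. t \<in> {a1<..<b1} \<Longrightarrow> f t > 0"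
    "a2 < b2" "{a2..b2} \<subseteq> {-pi..pi}" "\<And>t. t \<in> {a2<..<b2} \<Longrightarrow> f t > 0"
    "E_set f \<subseteq> cis ` ({a1..b1} \<union> {a2..b2})"
proof -
  obtain a0 b0 where ab0: "a0 < b0" "b0 - a0 \<le> 2 * pi" "cis ` {a0<..<b0} \<subseteq> E_set f"
      "E_set f \<subseteq> cis ` {a0..b0}"
    using assms unfolding is_arc_def by blast
  \<comment> \<open>The number of full turns that brings the left end into
    \<open>[-pi, pi)\<close>.\<close>
  define k where "k = - \<lfloor>(a0 + pi) / (2 * pi)\<rfloor>"
  define a b where "a = a0 + 2 * pi * of_int k" and "b = b0 + 2 * pi * of_int k"
  have k: "- of_int k \<le> (a0 + pi) / (2 * pi)" "(a0 + pi) / (2 * pi) < 1 - of_int k"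
    unfolding k_def by linarith+
  have "- of_int k * (2 * pi) \<le> a0 + pi" "a0 + pi < (1 - of_int k) * (2 * pi)"
    using k by (simp_all add: pos_le_divide_eq pos_divide_less_eq)
  then have a: "-pi \<le> a" "a < pi"
    by (simp_all add: a_def algebra_simps)
  have b: "a < b" "b - a \<le> 2 * pi" using ab0 by (auto simp: a_def b_def)
  have in_E: "cis t \<in> E_set f" if "t \<in> {a<..<b}" for t
  proof -
    have "t + 2 * pi * of_int (-k) \<in> {a0<..<b0}" using that by (simp add: a_def b_def)
    then have "cis (t + 2 * pi * of_int (-k)) \<in> E_set f" using ab0(3) by blast
    then show ?thesis unfolding cis_shift .
  qed
  have cover: "\<exists>t\<in>{a..b}. z = cis t" if "z \<in> E_set f" for z
  proof -
    from that ab0(4) obtain t where "t \<in> {a0..b0}" "z = cis t" by blast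
    then have "t + 2 * pi * of_int k \<in> {a..b}" "z = cis (t + 2 * pi * of_int k)"
      by (simp_all add: a_def b_def cis_shift)
    then show ?thesis by blast
  qed
  show thesis
  proof (cases "b \<le> pi")
    case True
    have pos: "f t > 0" if "t \<in> {a<..<b}" for t
      using that a True by (intro E_set_pos in_E) auto
    \<comment> \<open>The arc is not cut, and its one interval plays both roles.\<close>
    have sub: "E_set f \<subseteq> cis ` ({a..b} \<union> {a..b})"
      using cover by (simp add: subset_iff image_iff)
    have "{a..b} \<subseteq> {-pi..pi}" using a True by simp
    from that[OF b(1) this pos b(1) this pos sub] show ?thesis .
  next
    case False
    show ?thesis
    \<comment> \<open>The part beyond \<open>pi\<close> is turned back by \<open>2 * pi\<close>; it
      ends at or before \<open>a\<close>, because the length is at most a full turn.\<close>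
    proof (rule that[of a pi "-pi" "b - 2 * pi"])
      show "f t > 0" if "t \<in> {a<..<pi}" for t
        using that a False by (intro E_set_pos in_E) auto
      show "f t > 0" if "t \<in> {-pi<..<b - 2 * pi}" for t
      proof -
        have "cis (t + 2 * pi * of_int 1) \<in> E_set f"
          using that a by (intro in_E) auto
        then have "cis t \<in> E_set f" unfolding cis_shift .
        then show ?thesis using that a b by (intro E_set_pos) auto
      qed
      show "E_set f \<subseteq> cis ` ({a..pi} \<union> {-pi..b - 2 * pi})"
      proof
        fix z assume "z \<in> E_set f"
        from cover[OF this] obtain t where t: "t \<in> {a..b}" "z = cis t" ..
        show "z \<in> cis ` ({a..pi} \<union> {-pi..b - 2 * pi})"
        proof (cases "t \<le> pi")
          case True
          then show ?thesis using t by (intro image_eqI[of z cis t]) auto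
        next
          case False
          have "z = cis (t + 2 * pi * of_int (-1))" unfolding cis_shift by (rule t)
          moreover have "t + 2 * pi * of_int (-1) \<in> {-pi..b - 2 * pi}" using t False by simp
          ultimately show ?thesis by (intro image_eqI[of z cis]) auto
        qed
      qed
      show "{a..pi} \<subseteq> {-pi..pi}" "{-pi..b - 2 * pi} \<subseteq> {-pi..pi}" using a b by simp_all
    qed (use a False in simp_all)
  qed
qed

section \<open>Passage to the n-th roots\<close>

text \<open>Roots of constants tend to 1, so the upper limit of \<open>y\<close> is at most
  \<open>L\<close> and the lower limit at least \<open>L / C\<close> for every \<open>C > 1\<close>.
  Here \<open>B\<close> may depend on \<open>C\<close>.\<close>

lemma squeeze_root_rate:
  fixes x y :: "nat \<Rightarrow> real"
  assumes x: "x \<longlonglongrightarrow> L" "L \<ge> 0"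
    and upper: "A > 0" "\<And>n. n > 0 \<Longrightarrow> y n \<le> x n * root n A"
    and lower: "\<And>C. C > 1 \<Longrightarrow> \<exists>B>0. \<forall>n>0. x n \<le> root n B * C * y n"
  shows "y \<longlonglongrightarrow> L"
proof (rule order_tendstoI)
  fix a assume "L < a"
  have "(\<lambda>n. x n * root n A) \<longlonglongrightarrow> L * 1"
    using upper by (intro tendsto_intros x LIMSEQ_root_const)
  then have "\<forall>\<^sub>F n in sequentially. x n * root n A < a"
    using \<open>L < a\<close> by (intro order_tendstoD(2)) auto
  then show "\<forall>\<^sub>F n in sequentially. y n < a"
    using eventually_gt_at_top[of "0::nat"] by eventually_elim (rule le_less_trans[OF upper(2)])
next
  fix a assume "a < L"
  obtain C where C: "C > 1" "a * C < L"
  proof (cases "a > 0")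
    case True
    then have "1 < L / a" using \<open>a < L\<close> by simp
    then obtain C where "1 < C" "C < L / a" using dense by blast
    then show ?thesis using that[of C] True by (simp add: field_simps)
  next
    case False
    then show ?thesis using that[of 2] \<open>a < L\<close> x(2) by linarith
  qed
  obtain B where B: "B > 0" "\<And>n. n > 0 \<Longrightarrow> x n \<le> root n B * C * y n"
    using lower[OF C(1)] by blast
  have "(\<lambda>n. x n / root n B) \<longlonglongrightarrow> L / 1"
    using B by (intro tendsto_divide x LIMSEQ_root_const) auto
  then have "\<forall>\<^sub>F n in sequentially. a * C < x n / root n B"
    using C by (intro order_tendstoD(1)) auto
  then show "\<forall>\<^sub>F n in sequentially. a < y n"
    using eventually_gt_at_top[of "0::nat"]
  proof eventually_elim
    case (elim n)
    have "root n B > 0" using elim B by simp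
    then have "x n / root n B \<le> C * y n"
      using B(2)[of n] elim by (simp add: field_simps)
    then have "C * a < C * y n" using elim by (simp add: mult.commute)
    then show ?case using C by simp
  qed
qed

text \<open>Where \<open>f\<close> vanishes the integrand does too, so only the values of
  \<open>q\<close> on \<open>E_set f\<close> count.\<close>

lemma sigma_le_m_tilde:
  assumes f: "\<And>l. l \<in> {-pi..pi} \<Longrightarrow> f l \<ge> 0" "f integrable_on {-pi..pi}" "integral {-pi..pi} f > 0"
    and E: "bounded (E_set f)"
  shows "sigma f n \<le> m_tilde n (E_set f) * sqrt (integral {-pi..pi} f)"
proof -
  let ?S = "\<lambda>q. SUP z\<in>E_set f. cmod (poly q z)"
  let ?I = "\<lambda>q. integral {-pi..pi} (\<lambda>l. (cmod (poly q (cis l)))\<^sup>2 * f l)"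
  \<comment> \<open>The quotient form is a lower bound common to all \<open>q\<close>, hence one for
    the infimum \<open>m_tilde\<close>.\<close>
  have "sigma f n / sqrt (integral {-pi..pi} f) \<le> ?S q" if q: "q \<in> Qn1 n" for q
  proof -
    have I_nonneg: "0 \<le> ?I p" for p
      using integrable_weighted_poly[OF f(1,2)] f(1) by (intro integral_nonneg) auto
    have "sigma_sq f n \<le> ?I q"
      unfolding sigma_sq_def using q I_nonneg by (intro cInf_lower bdd_belowI2[where m = 0]) auto
    also have "\<dots> \<le> integral {-pi..pi} (\<lambda>l. (?S q)\<^sup>2 * f l)"
    proof (rule integral_le[OF integrable_weighted_poly[OF f(1,2)]])
      show "(\<lambda>l. (?S q)\<^sup>2 * f l) integrable_on {-pi..pi}"
        using f(2) by (rule integrable_on_mult_right)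
      fix l assume l: "l \<in> {-pi..pi}"
      show "(cmod (poly q (cis l)))\<^sup>2 * f l \<le> (?S q)\<^sup>2 * f l"
      proof (cases "f l = 0")
        case False
        then have "cis l \<in> E_set f" using f(1)[OF l] l by (auto simp: E_set_def)
        then show ?thesis
          using f(1)[OF l] by (intro mult_right_mono power_mono cmod_poly_le_SUP[OF E]) auto
      qed simp
    qed
    also have "\<dots> = (?S q)\<^sup>2 * integral {-pi..pi} f" by simp
    finally have "sigma f n \<le> sqrt ((?S q)\<^sup>2 * integral {-pi..pi} f)"
      unfolding sigma_def by (rule real_sqrt_le_mono)
    also have "\<dots> = ?S q * sqrt (integral {-pi..pi} f)"
    proof -
      \<comment> \<open>Taking the root of the square needs a nonnegative supremum, hence a nonempty
        set; this follows from the positive integral.\<close>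
      have "E_set f \<noteq> {}"
      proof
        assume "E_set f = {}"
        then have "f l = 0" if "l \<in> {-pi..pi}" for l
          using f(1)[OF that] that by (fastforce simp: E_set_def)
        then have "integral {-pi..pi} f = integral {-pi..pi} (\<lambda>_. 0)" by (intro integral_cong)
        then show False using f(3) by simp
      qed
      from SUP_cmod_poly_nonneg[OF E this] show ?thesis by (simp add: real_sqrt_mult)
    qed
    finally show ?thesis using f(3) by (simp add: pos_divide_le_eq)
  qed
  then have "sigma f n / sqrt (integral {-pi..pi} f) \<le> m_tilde n (E_set f)"
    by (rule m_tilde_ge)
  then show ?thesis using f(3) by (simp add: pos_divide_le_eq)
qed

lemma m_tilde_le_sigma:
  assumes f: "\<And>l. l \<in> {-pi..pi} \<Longrightarrow> f l \<ge> 0" "f integrable_on {-pi..pi}"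
    and E: "is_arc (E_set f)" "bounded (E_set f)" "E_set f \<noteq> {}" and C: "C > 1"
  shows "\<exists>B>0. \<forall>n>0. m_tilde n (E_set f) \<le> B * C ^ n * sigma f n"
proof -
  let ?I = "\<lambda>q. integral {-pi..pi} (\<lambda>l. (cmod (poly q (cis l)))\<^sup>2 * f l)"
  obtain a1 b1 a2 b2 where
    1: "a1 < b1" "{a1..b1} \<subseteq> {-pi..pi}" "\<And>t. t \<in> {a1<..<b1} \<Longrightarrow> f t > 0" and
    2: "a2 < b2" "{a2..b2} \<subseteq> {-pi..pi}" "\<And>t. t \<in> {a2<..<b2} \<Longrightarrow> f t > 0" and
    cover: "E_set f \<subseteq> cis ` ({a1..b1} \<union> {a2..b2})"
    using arc_E_set_cover[OF E(1)] by metis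
  obtain B1 where B1: "B1 > 0" "\<And>n q s t. \<lbrakk>n > 0; degree q \<le> n; s > ?I q; t \<in> {a1..b1}\<rbrakk>
      \<Longrightarrow> cmod (poly q (cis t)) \<le> B1 * C ^ n * sqrt s"
    using sup_bound_on_interval[OF f 1 C] by blast
  obtain B2 where B2: "B2 > 0" "\<And>n q s t. \<lbrakk>n > 0; degree q \<le> n; s > ?I q; t \<in> {a2..b2}\<rbrakk>
      \<Longrightarrow> cmod (poly q (cis t)) \<le> B2 * C ^ n * sqrt s"
    using sup_bound_on_interval[OF f 2 C] by blast
  define B where "B = max B1 B2"
  have "B > 0" using B1 by (simp add: B_def)
  have I_nonneg: "0 \<le> ?I q" for q
    using integrable_weighted_poly[OF f] f(1) by (intro integral_nonneg) auto
  have "m_tilde n (E_set f) \<le> B * C ^ n * sigma f n" if n: "n > 0" for n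
  proof -
    have pos: "0 < B * C ^ n" using \<open>B > 0\<close> C by simp
    \<comment> \<open>Attainment of the infimum \<open>sigma_sq\<close> is avoided: a polynomial
      with integral below \<open>s\<close> is used, and afterwards \<open>s\<close> decreases to
      \<open>sigma_sq f n\<close>.\<close>
    have "(m_tilde n (E_set f) / (B * C ^ n))\<^sup>2 \<le> s" if s: "sigma_sq f n < s" for s
    proof -
      obtain q where q: "q \<in> Qn1 n" "?I q < s"
        using s one_in_Qn1 unfolding sigma_sq_def by (auto dest!: cInf_lessD[rotated])
      have "s > 0" using q(2) I_nonneg[of q] by simp
      have "m_tilde n (E_set f) \<le> B * C ^ n * sqrt s"
      proof (rule m_tilde_le[OF E(2,3) q(1)])
        fix z assume "z \<in> E_set f"
        then obtain t where t: "t \<in> {a1..b1} \<or> t \<in> {a2..b2}" "z = cis t" using cover by blast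
        have dq: "degree q \<le> n" using q(1) by (simp add: Qn1_def)
        have "cmod (poly q z) \<le> B1 * C ^ n * sqrt s \<or> cmod (poly q z) \<le> B2 * C ^ n * sqrt s"
          using t B1(2)[OF n dq q(2)] B2(2)[OF n dq q(2)] by blast
        moreover have "B1 * C ^ n * sqrt s \<le> B * C ^ n * sqrt s" "B2 * C ^ n * sqrt s \<le> B * C ^ n * sqrt s"
          using C \<open>s > 0\<close> by (auto simp: B_def intro!: mult_right_mono)
        ultimately show "cmod (poly q z) \<le> B * C ^ n * sqrt s" by linarith
      qed
      then have "m_tilde n (E_set f) / (B * C ^ n) \<le> sqrt s"
        using pos by (simp add: pos_divide_le_eq mult.commute)
      moreover have "0 \<le> m_tilde n (E_set f) / (B * C ^ n)"
        using pos m_tilde_nonneg[OF E(2,3)] by (intro divide_nonneg_pos)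
      ultimately have "(m_tilde n (E_set f) / (B * C ^ n))\<^sup>2 \<le> (sqrt s)\<^sup>2"
        by (rule power_mono)
      then show ?thesis using \<open>s > 0\<close> by simp
    qed
    then have "(m_tilde n (E_set f) / (B * C ^ n))\<^sup>2 \<le> sigma_sq f n"
      by (rule dense_ge)
    then have "m_tilde n (E_set f) / (B * C ^ n) \<le> sigma f n"
      unfolding sigma_def by (rule real_le_rsqrt)
    then show ?thesis using pos by (simp add: pos_divide_le_eq mult.commute)
  qed
  then show ?thesis using \<open>B > 0\<close> by blast
qed

theorem theorem8p1:
  fixes f :: "real \<Rightarrow> real"
  assumes "\<And>l. l \<in> {-pi..pi} \<Longrightarrow> f l \<ge> 0"
    and "f integrable_on {-pi..pi}"
    and "integral {-pi..pi} f > 0"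
    and "is_arc (E_set f) \<or> E_set f = sphere 0 1"
  shows "(\<lambda>n. root n (sigma f n)) \<longlonglongrightarrow> tau_tilde (E_set f) \<and> tau_tilde (E_set f) \<le> 1"
proof
  have arc: "is_arc (E_set f)" using assms(4) is_arc_sphere by auto
  have "E_set f \<subseteq> cball 0 1" by (auto simp: E_set_def)
  then have bdd: "bounded (E_set f)" by (rule bounded_subset[OF bounded_cball])
  have ne: "E_set f \<noteq> {}"
  proof -
    obtain a b where "a < b" "cis ` {a<..<b} \<subseteq> E_set f"
      using arc unfolding is_arc_def by blast
    moreover from this obtain t where "a < t" "t < b" using dense by blast
    ultimately show ?thesis by auto
  qed
  show "tau_tilde (E_set f) \<le> 1" by (rule tau_tilde_le_1[OF bdd ne])
  have lim: "(\<lambda>n. root n (m_tilde n (E_set f))) \<longlonglongrightarrow> tau_tilde (E_set f)"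
    by (rule tau_tilde_LIMSEQ[OF bdd ne])
  show "(\<lambda>n. root n (sigma f n)) \<longlonglongrightarrow> tau_tilde (E_set f)"
  proof (rule squeeze_root_rate[OF lim])
    show "0 \<le> tau_tilde (E_set f)"
    proof (rule LIMSEQ_le_const[OF lim], intro exI allI impI)
      fix n :: nat assume "n \<ge> 1"
      then show "0 \<le> root n (m_tilde n (E_set f))" using m_tilde_nonneg[OF bdd ne] by simp
    qed
    show "0 < sqrt (integral {-pi..pi} f)" using assms(3) by simp
    show "root n (sigma f n) \<le> root n (m_tilde n (E_set f)) * root n (sqrt (integral {-pi..pi} f))"
      if "n > 0" for n
      unfolding real_root_mult[symmetric]
      using that sigma_le_m_tilde[OF assms(1-3) bdd] by (intro real_root_le_mono)
    fix C :: real assume C: "C > 1"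
    obtain B where B: "B > 0" "\<And>n. n > 0 \<Longrightarrow> m_tilde n (E_set f) \<le> B * C ^ n * sigma f n"
      using m_tilde_le_sigma[OF assms(1,2) arc bdd ne C] by blast
    have "root n (m_tilde n (E_set f)) \<le> root n B * C * root n (sigma f n)" if "n > 0" for n
    proof -
      have "root n (m_tilde n (E_set f)) \<le> root n (B * C ^ n * sigma f n)"
        using that B(2) by (intro real_root_le_mono)
      also have "\<dots> = root n B * C * root n (sigma f n)"
        using that C by (simp add: real_root_mult real_root_power_cancel)
      finally show ?thesis .
    qed
    then show "\<exists>B>0. \<forall>n>0. root n (m_tilde n (E_set f)) \<le> root n B * C * root n (sigma f n)"
      using B(1) by blast
  qed
qed

end
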